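(* The set $$\left\{ \begin{pmatrix} 1 & k \\ 0 & 1 \end{pmatrix} \,:\, k \in \mathbb{N} \right\} \subset \mathrm{SL}_2(\mathbb{C})$$ is $G$-tame for $G = \mathrm{Aut}(\mathrm{SL}_2(\mathbb{C}))$.
   Context: $\mathbb{N} = \{1,2,3,\dots\}$. For a complex manifold $X$, $\mathrm{Aut}(X)$ denotes its group of holomorphic automorphisms (for $X = \mathrm{SL}_2(\mathbb{C})$, biholomorphic self-maps of the underlying complex manifold). For a subgroup $G \subseteq \mathrm{Aut}(X)$, a closed discrete infinite set $A \subset X$ is called $G$-tame if for every injective mapping $f \colon A \to A$ there exists $F \in G$ such that $F|_A = f$. *)

theory Defs
  imports "HOL-Analysis.Analysis" "HOL-Algebra.Bij"
begin

definition SL2C :: "(complex^2^2) set" where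
  "SL2C = {M. det M = 1}"

text \<open>
  Scalar multiplication of matrices by complex numbers. (The library's \<open>*s\<close> would take a scalar
  from the row type, and \<open>*\<^sub>R\<close> only a real one.)
\<close>

definition cscale :: "complex \<Rightarrow> complex^'n^'m \<Rightarrow> complex^'n^'m" where
  "cscale c M = (\<chi> i j. c * M $ i $ j)"

definition holomorphic_map_on ::
    "(complex^'n^'m \<Rightarrow> complex^'q^'p) \<Rightarrow> (complex^'n^'m) set \<Rightarrow> bool" where
  "holomorphic_map_on f U \<longleftrightarrow>
     open U \<and>
     (\<forall>x\<in>U. \<exists>D. (f has_derivative D) (at x) \<and> (\<forall>c v. D (cscale c v) = cscale c (D v)))"

text \<open>
  For embedded complex submanifolds \<open>X\<close> and \<open>Y\<close> of complex matrix spaces, a map from \<open>X\<close> to \<open>Y\<close> is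
  holomorphic iff locally, near every point of \<open>X\<close>, it is the restriction of a holomorphic map
  defined on an open subset of the ambient space. The group \<open>SL2C\<close> is a closed complex
  hypersurface of \<open>2 \<times> 2\<close> matrices, as \<open>1\<close> is a regular value of the determinant.
\<close>

definition holomorphic_between ::
    "(complex^'n^'m) set \<Rightarrow> (complex^'q^'p) set \<Rightarrow> (complex^'n^'m \<Rightarrow> complex^'q^'p) \<Rightarrow> bool" where
  "holomorphic_between X Y f \<longleftrightarrow>
     f \<in> X \<rightarrow> Y \<and>
     (\<forall>x\<in>X. \<exists>U g. x \<in> U \<and> holomorphic_map_on g U \<and> (\<forall>y\<in>X \<inter> U. g y = f y))"

text \<open>
  As in \<^const>\<open>Bij\<close>, automorphisms are extensional functions, so that they are determined
  by their values on \<open>X\<close>.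
\<close>

definition Aut :: "(complex^'n^'m) set \<Rightarrow> (complex^'n^'m \<Rightarrow> complex^'n^'m) set" where
  "Aut X = {F \<in> Bij X. holomorphic_between X X F \<and> holomorphic_between X X (inv_into X F)}"

text \<open>
  In use, \<open>G\<close> is the carrier of a group of automorphisms of \<open>X\<close>.
\<close>

definition tame :: "'a::topological_space set \<Rightarrow> ('a \<Rightarrow> 'a) set \<Rightarrow> 'a set \<Rightarrow> bool" where
  "tame X G A \<longleftrightarrow>
     closedin (top_of_set X) A \<and> discrete A \<and> infinite A \<and>
     (\<forall>f. f \<in> A \<rightarrow> A \<and> inj_on f A \<longrightarrow> (\<exists>F\<in>G. \<forall>a\<in>A. F a = f a))"

lemma holomorphic_between_cong:
  assumes "holomorphic_between X Y f" "\<And>x. x \<in> X \<Longrightarrow> f x = g x"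
  shows "holomorphic_between X Y g"
  using assms unfolding holomorphic_between_def by (fastforce simp: Pi_iff)

lemma holomorphic_between_ident:
  fixes X :: "(complex^'n^'m) set"
  shows "holomorphic_between X X (\<lambda>x. x)"
proof -
  have "holomorphic_map_on (\<lambda>x::complex^'n^'m. x) UNIV"
    unfolding holomorphic_map_on_def by (auto intro!: exI[of _ "\<lambda>x. x"] derivative_intros)
  then show ?thesis
    unfolding holomorphic_between_def by blast
qed

lemma holomorphic_between_comp:
  assumes f: "holomorphic_between X Y f" and g: "holomorphic_between Y Z g"
  shows "holomorphic_between X Z (\<lambda>x. g (f x))"
  unfolding holomorphic_between_def
proof (intro conjI ballI)
  show "(\<lambda>x. g (f x)) \<in> X \<rightarrow> Z"
    using f g unfolding holomorphic_between_def by auto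
  fix x assume x: "x \<in> X"
  then obtain U f' where U: "x \<in> U" "holomorphic_map_on f' U" "\<forall>y\<in>X \<inter> U. f' y = f y"
    using f unfolding holomorphic_between_def by blast
  have fx: "f x \<in> Y"
    using f x unfolding holomorphic_between_def by auto
  then obtain V g' where V: "f x \<in> V" "holomorphic_map_on g' V" "\<forall>y\<in>Y \<inter> V. g' y = g y"
    using g unfolding holomorphic_between_def by blast
  define W where "W = U \<inter> f' -` V"
  have "continuous_on U f'"
    using U(2) unfolding holomorphic_map_on_def
    by (meson continuous_at_imp_continuous_on has_derivative_continuous)
  then have "open W"
    using U(2) V(2) unfolding holomorphic_map_on_def W_def
    by (metis continuous_on_open_vimage Int_commute)
  moreover have "\<exists>D. ((\<lambda>z. g' (f' z)) has_derivative D) (at y) \<and>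
      (\<forall>c v. D (cscale c v) = cscale c (D v))" if y: "y \<in> W" for y
  proof -
    obtain D where D: "(f' has_derivative D) (at y)" "\<forall>c v. D (cscale c v) = cscale c (D v)"
      using U(2) y unfolding holomorphic_map_on_def W_def by blast
    obtain E where E: "(g' has_derivative E) (at (f' y))" "\<forall>c v. E (cscale c v) = cscale c (E v)"
      using V(2) y unfolding holomorphic_map_on_def W_def by blast
    have "((\<lambda>z. g' (f' z)) has_derivative (\<lambda>v. E (D v))) (at y)"
      using has_derivative_compose[OF D(1) E(1)] .
    then show ?thesis
      using D(2) E(2) by (intro exI[of _ "\<lambda>v. E (D v)"]) simp
  qed
  ultimately have "holomorphic_map_on (\<lambda>z. g' (f' z)) W"
    unfolding holomorphic_map_on_def by blast
  moreover have "x \<in> W"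
    using U V x by (simp add: W_def)
  moreover have "\<forall>y\<in>X \<inter> W. g' (f' y) = g (f y)"
    using U(3) V(3) f unfolding W_def holomorphic_between_def by (auto simp: Pi_iff)
  ultimately show "\<exists>U h. x \<in> U \<and> holomorphic_map_on h U \<and> (\<forall>y\<in>X \<inter> U. h y = g (f y))"
    by blast
qed

theorem subgroup_Aut: "subgroup (Aut X) (BijGroup X)"
proof (rule group.subgroupI[OF group_BijGroup])
  show "Aut X \<subseteq> carrier (BijGroup X)"
    by (auto simp: Aut_def BijGroup_def)
  have "inv_into X (\<lambda>x\<in>X. x) x = x" if "x \<in> X" for x
    by (rule inv_into_f_eq) (use that in \<open>auto simp: inj_on_def\<close>)
  then have "(\<lambda>x\<in>X. x) \<in> Aut X"
    unfolding Aut_def using id_Bij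
    by (auto intro!: holomorphic_between_cong[OF holomorphic_between_ident])
  then show "Aut X \<noteq> {}" by blast
next
  fix F assume F: "F \<in> Aut X"
  then have B: "F \<in> Bij X" by (simp add: Aut_def)
  then have b: "bij_betw F X X" by (simp add: Bij_def)
  let ?H = "\<lambda>x\<in>X. inv_into X F x"
  have H: "?H \<in> Bij X" by (rule restrict_inv_into_Bij[OF B])
  then have bH: "inj_on ?H X" by (simp add: Bij_def bij_betw_def)
  have "inv_into X ?H x = F x" if x: "x \<in> X" for x
    using b x by (intro inv_into_f_eq[OF bH]) (auto simp: bij_betw_def)
  then have i: "\<And>x. x \<in> X \<Longrightarrow> F x = inv_into X ?H x" by simp
  have "holomorphic_between X X (inv_into X ?H)"
    by (rule holomorphic_between_cong[of X X F]) (use F i in \<open>auto simp: Aut_def\<close>)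
  moreover have "holomorphic_between X X ?H"
    by (rule holomorphic_between_cong[of X X "inv_into X F"]) (use F in \<open>auto simp: Aut_def\<close>)
  ultimately have "?H \<in> Aut X"
    using H unfolding Aut_def by blast
  then show "inv\<^bsub>BijGroup X\<^esub> F \<in> Aut X"
    using inv_BijGroup[OF B] by simp
next
  fix F H assume F: "F \<in> Aut X" and H: "H \<in> Aut X"
  then have B: "F \<in> Bij X" "H \<in> Bij X" by (auto simp: Aut_def)
  then have b: "bij_betw F X X" "bij_betw H X X" by (auto simp: Bij_def)
  have C: "compose X F H \<in> Bij X" by (rule compose_Bij[OF B])
  then have i: "inj_on (compose X F H) X" by (simp add: Bij_def bij_betw_def)
  have "inv_into X (compose X F H) x = inv_into X H (inv_into X F x)" if x: "x \<in> X" for x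
  proof (rule inv_into_f_eq[OF i])
    have m: "inv_into X F x \<in> X"
      using b(1) x by (metis bij_betw_def inv_into_into)
    then show m': "inv_into X H (inv_into X F x) \<in> X"
      using b(2) by (metis bij_betw_def inv_into_into)
    show "compose X F H (inv_into X H (inv_into X F x)) = x"
      using m m' b x by (simp add: compose_def bij_betw_inv_into_right)
  qed
  moreover have "holomorphic_between X X (\<lambda>x. inv_into X H (inv_into X F x))"
    using F H unfolding Aut_def by (blast intro: holomorphic_between_comp)
  ultimately have "holomorphic_between X X (inv_into X (compose X F H))"
    by (metis (no_types, lifting) holomorphic_between_cong)
  moreover have "holomorphic_between X X (\<lambda>x. F (H x))"
    using F H unfolding Aut_def by (blast intro: holomorphic_between_comp)
  then have "holomorphic_between X X (compose X F H)"
    by (rule holomorphic_between_cong) (simp add: compose_def)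
  ultimately have "compose X F H \<in> Aut X"
    using C unfolding Aut_def by blast
  then show "F \<otimes>\<^bsub>BijGroup X\<^esub> H \<in> Aut X"
    using B by (simp add: BijGroup_def)
qed

end

theory Submission
  imports Defs "HOL-Complex_Analysis.Cauchy_Integral_Formula"
begin

text \<open>
  An injective self-map of the set of matrices $A_k$ with rows $(1, k)$ and $(0, 1)$ has the form
  $A_k \mapsto A_{m(k)}$ for an injective map $m$ of the positive integers. For an entire function
  $h$, adding $h(b)$ times the second column to the first, where $b$ is the upper right entry of
  the matrix, is an automorphism of the special linear group: it fixes $b$, so the same shear with
  $-h$ undoes it. Two such shears and a transposition are enough. Choose an entire $s$ with
  $s(k) = m(k)$ and an entire $u$ with $u(m(k)) = -k$, for all $k \ge 1$. Shearing by $s$,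
  transposing, and then shearing by $u$ acts on $A_k$, with matrices written row by row, as
  $(1, k; 0, 1) \mapsto (1 + k m(k), k; m(k), 1) \mapsto (1 + k m(k), m(k); k, 1)
  \mapsto (1, m(k); 0, 1)$.

  Injectivity of $m$ is what makes the conditions on $u$ consistent, and it also makes the nodes
  $m(k)$ tend to infinity. The functions $s$ and $u$ then exist because an entire function can take
  arbitrary prescribed values along a sequence of distinct points tending to infinity
  (\<open>entire_interpolation\<close>).
\<close>

section \<open>Interpolation by entire functions\<close>

text \<open>
  The Lagrange polynomial $L$ with zeros $S$ and $L(a) = w$ has all the properties except the bound.
  For $a \neq 0$, multiplying it by $(z/a)^m$ keeps the zeros and the value at $a$, and makes it
  small on the disc of radius $|a|/2$ when $m$ is large.
\<close>

lemma entire_small_with_zeros: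
  fixes a w :: complex
  assumes "finite S" "a \<notin> S" "e > 0"
  shows "\<exists>q. q holomorphic_on UNIV \<and> (\<forall>s\<in>S. q s = 0) \<and> q a = w \<and>
    (\<forall>z. 2 * norm z < norm a \<longrightarrow> norm (q z) \<le> e)"
proof -
  define L where "L z = w * (\<Prod>s\<in>S. (z - s) / (a - s))" for z
  have hol: "L holomorphic_on A" for A
    unfolding L_def using assms(2) by (intro holomorphic_intros) auto
  have zero: "L s = 0" if "s \<in> S" for s
    unfolding L_def using that assms(1) by force
  have "(\<Prod>s\<in>S. (a - s) / (a - s)) = 1"
    using assms(2) by (intro prod.neutral) auto
  then have La: "L a = w"
    unfolding L_def by simp
  show ?thesis
  proof (cases "a = 0")
    case True
    \<comment> \<open>The disc on which a bound is required is empty.\<close>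
    then show ?thesis
      using hol zero La by (intro exI[of _ L]) auto
  next
    case False
    have "compact (L ` cball 0 (norm a))"
      using hol by (intro compact_continuous_image holomorphic_on_imp_continuous_on) auto
    then obtain B where B: "B > 0" "\<And>z. z \<in> cball 0 (norm a) \<Longrightarrow> norm (L z) \<le> B"
      using compact_imp_bounded bounded_pos by (metis imageI)
    obtain m where m: "(1 / 2) ^ m < e / B"
      using real_arch_pow_inv[of "e / B" "1 / 2"] assms(3) B(1) by auto
    define q where "q z = L z * (z / a) ^ m" for z
    have "norm (q z) \<le> e" if z: "2 * norm z < norm a" for z
    proof -
      have "norm (z / a) \<le> 1 / 2"
        using z False by (simp add: norm_divide field_simps)
      then have "norm (z / a) ^ m \<le> (1 / 2) ^ m"
        by (intro power_mono) auto
      moreover have "norm (L z) \<le> B"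
        using z norm_ge_zero[of z] by (intro B) (simp del: norm_ge_zero)
      ultimately have "norm (q z) \<le> B * (1 / 2) ^ m"
        unfolding q_def norm_mult norm_power by (intro mult_mono) (use B in auto)
      also have "\<dots> \<le> e"
        using m B(1) by (simp add: field_simps)
      finally show ?thesis .
    qed
    moreover have "q holomorphic_on UNIV"
      unfolding q_def using False by (intro holomorphic_intros hol) auto
    ultimately show ?thesis
      using zero La False by (intro exI[of _ q]) (auto simp: q_def)
  qed
qed

text \<open>
  The interpolating function is a sum of entire functions of which the one with index \<open>n\<close> vanishes
  at all earlier nodes and corrects the value that the previous ones have at \<open>p n\<close>, so that only
  finitely many terms contribute at each node. The size \<open>(1 / 2) ^ n\<close> of this term on the disc of
  radius \<open>norm (p n) / 2\<close>, whatever the correction, gives locally uniform convergence, since these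
  discs exhaust the plane.
\<close>

theorem entire_interpolation:
  fixes p g :: "nat \<Rightarrow> complex"
  assumes "inj p" and fin: "\<And>R. finite {n. norm (p n) \<le> R}"
  obtains u where "u holomorphic_on UNIV" "\<And>n. u (p n) = g n"
proof -
  define P where "P q n r \<longleftrightarrow> r holomorphic_on UNIV \<and> (\<forall>s\<in>p ` {..<n}. r s = 0) \<and>
      r (p n) = g n - (\<Sum>j<n. q j (p n)) \<and>
      (\<forall>z. 2 * norm z < norm (p n) \<longrightarrow> norm (r z) \<le> (1 / 2) ^ n)"
    for q and n :: nat and r :: "complex \<Rightarrow> complex"
  have "\<exists>q. \<forall>n. P q n (q n)"
  proof (rule dependent_wellorder_choice)
    show "P q n r = P q' n r" if "\<And>j. j < n \<Longrightarrow> q j = q' j" for r q q' n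
      using that unfolding P_def by simp
  next
    fix n q
    have "p n \<notin> p ` {..<n}"
      using \<open>inj p\<close> by (auto dest: injD)
    then show "\<exists>r. P q n r"
      unfolding P_def by (intro entire_small_with_zeros) auto
  qed
  then obtain q where q: "\<And>n. P q n (q n)"
    by blast
  have "(q n has_field_derivative deriv (q n) z) (at z)" for n z
    using q[of n] unfolding P_def by (auto intro: holomorphic_derivI)
  moreover have "\<exists>d h. 0 < d \<and> summable h \<and>
      (\<forall>\<^sub>F n in sequentially. \<forall>y\<in>ball x d \<inter> UNIV. norm (q n y) \<le> h n)" for x
  proof (intro exI conjI)
    show "summable (\<lambda>n. (1 / 2) ^ n :: real)"
      by (intro summable_geometric) auto
    have "\<forall>\<^sub>F n in sequentially. \<not> norm (p n) \<le> 2 * (norm x + 1)"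
      using fin by (simp add: cofinite_eq_sequentially[symmetric] eventually_cofinite)
    then show "\<forall>\<^sub>F n in sequentially. \<forall>y\<in>ball x 1 \<inter> UNIV. norm (q n y) \<le> (1 / 2) ^ n"
    proof (rule eventually_mono, intro ballI)
      fix n y assume n: "\<not> norm (p n) \<le> 2 * (norm x + 1)" and "y \<in> ball x 1 \<inter> UNIV"
      then have "norm y < norm x + 1"
        using norm_triangle_ineq2[of y x] by (auto simp: dist_norm norm_minus_commute)
      then show "norm (q n y) \<le> (1 / 2) ^ n"
        using q[of n] n unfolding P_def by auto
    qed
  qed simp
  ultimately obtain u u' where u: "\<And>z. (\<lambda>n. q n z) sums u z"
      and u': "\<And>z. (u has_field_derivative u' z) (at z)"
    using series_and_derivative_comparison_local[of UNIV q "\<lambda>n. deriv (q n)"] by (simp, metis)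
  have "u (p n) = g n" for n
  proof -
    have "(\<lambda>j. q j (p n)) sums (\<Sum>j\<in>{..n}. q j (p n))"
      using q unfolding P_def by (intro sums_finite) auto
    also have "(\<Sum>j\<in>{..n}. q j (p n)) = g n"
      using q[of n] unfolding P_def by (simp add: lessThan_Suc_atMost[symmetric])
    finally show ?thesis
      using u sums_unique2 by blast
  qed
  moreover have "u holomorphic_on UNIV"
    using u' by (auto simp: holomorphic_on_open)
  ultimately show ?thesis
    using that by blast
qed

corollary entire_interpolation_nat:
  fixes m :: "nat \<Rightarrow> nat" and g :: "nat \<Rightarrow> complex"
  assumes "inj m"
  obtains u where "u holomorphic_on UNIV" "\<And>n. u (of_nat (m n)) = g n"
proof (rule entire_interpolation[of "\<lambda>n. of_nat (m n)" g])
  show "inj (\<lambda>n. of_nat (m n) :: complex)"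
    using assms by (simp add: inj_def)
  fix R :: real
  have "finite (m -` {..nat \<lfloor>R\<rfloor>})"
    using assms by (intro finite_vimageI) auto
  then show "finite {n. norm (of_nat (m n) :: complex) \<le> R}"
    by (rule rev_finite_subset) (auto simp: le_nat_floor)
qed (use that in blast)

section \<open>Automorphisms of the special linear group\<close>

lemma restrict_in_Aut:
  assumes F: "holomorphic_between X X F" and G: "holomorphic_between X X G"
    and "\<And>x. x \<in> X \<Longrightarrow> G (F x) = x" "\<And>x. x \<in> X \<Longrightarrow> F (G x) = x"
  shows "restrict F X \<in> Aut X"
proof -
  have m: "F \<in> X \<rightarrow> X" "G \<in> X \<rightarrow> X"
    using F G unfolding holomorphic_between_def by auto
  then have bij: "bij_betw (restrict F X) X X"
    using assms(3,4) by (intro bij_betwI[of _ _ _ G]) auto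
  have "inv_into X (restrict F X) x = G x" if "x \<in> X" for x
    using bij m assms(4) that by (intro inv_into_f_eq) (auto simp: bij_betw_def)
  then have "holomorphic_between X X (inv_into X (restrict F X))"
    using holomorphic_between_cong[OF G] by metis
  moreover have "holomorphic_between X X (restrict F X)"
    by (rule holomorphic_between_cong[OF F]) simp
  ultimately show ?thesis
    using bij by (simp add: Aut_def Bij_def)
qed

lemma has_derivative_vec_lambda:
  fixes f :: "'i::finite \<Rightarrow> 'a::real_normed_vector \<Rightarrow> 'b::euclidean_space"
  assumes "\<And>i. (f i has_derivative D i) (at x within S)"
  shows "((\<lambda>y. \<chi> i. f i y) has_derivative (\<lambda>v. \<chi> i. D i v)) (at x within S)"
  unfolding has_derivative_componentwise_within[of "\<lambda>y. \<chi> i. f i y"]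
  using assms by (auto simp: Basis_vec_def inner_axis intro: has_derivative_inner_left)

lemma holomorphic_between_transpose: "holomorphic_between SL2C SL2C transpose"
proof -
  have "(transpose has_derivative transpose) (at x)" for x :: "complex^2^2"
    unfolding transpose_def
    by (intro has_derivative_vec_lambda bounded_linear_imp_has_derivative
        bounded_linear_compose[OF bounded_linear_vec_nth] bounded_linear_vec_nth)
  moreover have "transpose (cscale c v) = cscale c (transpose v)" for c and v :: "complex^2^2"
    by (simp add: transpose_def cscale_def vec_eq_iff)
  ultimately have "holomorphic_map_on (transpose :: complex^2^2 \<Rightarrow> _) UNIV"
    unfolding holomorphic_map_on_def by blast
  then show ?thesis
    unfolding holomorphic_between_def SL2C_def by (auto simp: det_transpose)
qed

definition shear :: "(complex \<Rightarrow> complex) \<Rightarrow> complex^2^2 \<Rightarrow> complex^2^2" where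
  "shear h M = M ** vector [vector [1, 0], vector [h (M $ 1 $ 2), 1]]"

lemma shear_nth [simp]:
  "shear h M $ i $ 1 = M $ i $ 1 + h (M $ 1 $ 2) * M $ i $ 2"
  "shear h M $ i $ 2 = M $ i $ 2"
  by (simp_all add: shear_def matrix_matrix_mult_def sum_2)

lemma shear_uminus: "shear (\<lambda>z. - h z) (shear h M) = M" "shear h (shear (\<lambda>z. - h z) M) = M"
  by (simp_all add: vec_eq_iff forall_2)

text \<open>
  The product rule gives a derivative on the whole matrix space, complex linear because the
  derivative of \<open>h\<close> is multiplication by a complex number. The determinant is kept because
  \<^const>\<open>shear\<close> adds a multiple of one column to the other.
\<close>

lemma holomorphic_between_shear:
  assumes "h holomorphic_on UNIV"
  shows "holomorphic_between SL2C SL2C (shear h)"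
proof -
  define D :: "complex^2^2 \<Rightarrow> complex^2^2 \<Rightarrow> complex^2^2" where "D M v = (\<chi> i j. if j = 1
      then v $ i $ 1 + (h (M $ 1 $ 2) * v $ i $ 2 + deriv h (M $ 1 $ 2) * v $ 1 $ 2 * M $ i $ 2)
      else v $ i $ 2)" for M v
  have shear_eq: "shear h = (\<lambda>M. \<chi> i j. if j = 1
      then M $ i $ 1 + h (M $ 1 $ 2) * M $ i $ 2 else M $ i $ 2)"
    by (simp add: fun_eq_iff vec_eq_iff forall_2)
  have nth: "((\<lambda>M. M $ i $ j) has_derivative (\<lambda>v. v $ i $ j)) (at M)"
    for i j :: 2 and M :: "complex^2^2"
    by (intro bounded_linear_imp_has_derivative bounded_linear_compose[OF bounded_linear_vec_nth]
        bounded_linear_vec_nth)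
  have h: "((\<lambda>M. h (M $ 1 $ 2)) has_derivative (\<lambda>v. deriv h (M $ 1 $ 2) * v $ 1 $ 2)) (at M)"
    for M :: "complex^2^2"
  proof -
    have "(h has_field_derivative deriv h (M $ 1 $ 2)) (at (M $ 1 $ 2))"
      using assms by (auto intro: holomorphic_derivI)
    then show ?thesis
      using has_derivative_compose[OF nth] unfolding has_field_derivative_def by blast
  qed
  have "(shear h has_derivative D M) (at M)" for M
    unfolding shear_eq D_def
  proof (intro has_derivative_vec_lambda)
    fix i j :: 2
    show "((\<lambda>M. if j = 1 then M $ i $ 1 + h (M $ 1 $ 2) * M $ i $ 2 else M $ i $ 2) has_derivative
        (\<lambda>v. if j = 1 then v $ i $ 1 +
          (h (M $ 1 $ 2) * v $ i $ 2 + deriv h (M $ 1 $ 2) * v $ 1 $ 2 * M $ i $ 2)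
        else v $ i $ 2)) (at M)"
      by (cases "j = 1")
        (simp_all add: nth has_derivative_add[OF nth has_derivative_mult[OF h nth]])
  qed
  moreover have "D M (cscale c v) = cscale c (D M v)" for M c v
    by (simp add: D_def cscale_def vec_eq_iff algebra_simps)
  ultimately have "holomorphic_map_on (shear h) UNIV"
    unfolding holomorphic_map_on_def by blast
  moreover have "shear h \<in> SL2C \<rightarrow> SL2C"
    by (auto simp: SL2C_def det_2 algebra_simps)
  ultimately show ?thesis
    unfolding holomorphic_between_def by blast
qed

lemma shear_transpose_shear_in_Aut:
  assumes s: "s holomorphic_on UNIV" and u: "u holomorphic_on UNIV"
  shows "(\<lambda>M\<in>SL2C. shear u (transpose (shear s M))) \<in> Aut SL2C"
proof (rule restrict_in_Aut)
  have s': "(\<lambda>z. - s z) holomorphic_on UNIV" and u': "(\<lambda>z. - u z) holomorphic_on UNIV"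
    using s u by (auto intro: holomorphic_intros)
  note T = holomorphic_between_transpose and S = holomorphic_between_shear
  show "holomorphic_between SL2C SL2C (\<lambda>M. shear u (transpose (shear s M)))"
    by (rule holomorphic_between_comp[OF holomorphic_between_comp[OF S[OF s] T] S[OF u]])
  show "holomorphic_between SL2C SL2C
      (\<lambda>M. shear (\<lambda>z. - s z) (transpose (shear (\<lambda>z. - u z) M)))"
    by (rule holomorphic_between_comp[OF holomorphic_between_comp[OF S[OF u'] T] S[OF s']])
qed (simp_all add: shear_uminus)

section \<open>The unipotent matrices\<close>

definition unipotent :: "nat \<Rightarrow> complex^2^2" where
  "unipotent k = vector [vector [1, of_nat k], vector [0, 1]]"

lemma unipotent_nth [simp]:
  "unipotent k $ 1 $ 1 = 1" "unipotent k $ 1 $ 2 = of_nat k"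
  "unipotent k $ 2 $ 1 = 0" "unipotent k $ 2 $ 2 = 1"
  by (simp_all add: unipotent_def)

lemma unipotent_in_SL2C: "unipotent k \<in> SL2C"
  by (simp add: SL2C_def det_2)

lemma dist_unipotent: "dist (unipotent j) (unipotent k) \<ge> \<bar>real j - real k\<bar>"
proof -
  have "\<bar>real j - real k\<bar> = dist (unipotent j $ 1 $ 2) (unipotent k $ 1 $ 2)"
    by (simp add: dist_norm) (metis norm_of_real of_real_diff of_real_of_nat_eq)
  also have "\<dots> \<le> dist (unipotent j) (unipotent k)"
    by (meson dist_vec_nth_le order_trans)
  finally show ?thesis .
qed

lemma unipotent_eq_iff [simp]: "unipotent j = unipotent k \<longleftrightarrow> j = k"
  using dist_unipotent[of j k] by auto

lemma uniform_discrete_unipotent: "uniform_discrete (unipotent ` K)"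
  unfolding uniform_discrete_def
proof (intro exI[of _ 1] conjI ballI impI)
  fix x y assume "x \<in> unipotent ` K" "y \<in> unipotent ` K" and d: "dist x y < 1"
  then obtain j k where jk: "x = unipotent j" "y = unipotent k"
    by blast
  then have "\<bar>real j - real k\<bar> < 1"
    using d dist_unipotent[of j k] by simp
  then show "x = y"
    using jk by simp
qed simp

text \<open>
  The first shear writes the target \<open>l\<close> into the lower left entry while \<open>k\<close> is still present in
  the upper right one. The transposition exchanges the two, and the second shear, which now sees
  \<open>l\<close>, erases \<open>k\<close>.
\<close>

lemma shear_transpose_shear_unipotent:
  assumes "s (of_nat k) = of_nat l" "u (of_nat l) = - of_nat k"
  shows "shear u (transpose (shear s (unipotent k))) = unipotent l"
  using assms by (simp add: vec_eq_iff forall_2 transpose_def)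

theorem lemma4p1:
  shows "tame SL2C (Aut SL2C)
    {vector [vector [1, of_nat k], vector [0, 1]] | k :: nat. k \<ge> 1}"
proof -
  \<comment> \<open>The positive integers are written as successors, so that the nodes form a sequence.\<close>
  let ?A = "range (\<lambda>n. unipotent (Suc n))"
  have "{vector [vector [1, of_nat k], vector [0, 1]] | k :: nat. k \<ge> 1} = unipotent ` {1..}"
    unfolding unipotent_def by blast
  also have "{1..} = range Suc"
    by (metis One_nat_def greaterThan_0 atLeast_Suc_greaterThan)
  finally have A: "{vector [vector [1, of_nat k], vector [0, 1]] | k :: nat. k \<ge> 1} = ?A"
    by (simp add: image_image)
  have ud: "uniform_discrete ?A"
    using uniform_discrete_unipotent[of "range Suc"] by (simp add: image_image)
  have inj: "inj (\<lambda>n. unipotent (Suc n))"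
    by (simp add: inj_def)
  have "\<exists>F\<in>Aut SL2C. \<forall>a\<in>?A. F a = f a" if f: "f \<in> ?A \<rightarrow> ?A" "inj_on f ?A" for f
  proof -
    have "\<exists>l. f (unipotent (Suc n)) = unipotent l" for n
      using f(1) by blast
    then obtain m where m: "\<And>n. f (unipotent (Suc n)) = unipotent (m n)"
      by metis
    have "inj (\<lambda>n. f (unipotent (Suc n)))"
      using comp_inj_on[OF inj f(2)] by (simp add: comp_def)
    then have "inj m"
      unfolding m by (simp add: inj_def)
    obtain s where s: "s holomorphic_on UNIV" "\<And>n. s (of_nat (Suc n)) = of_nat (m n)"
      using entire_interpolation_nat[of Suc "\<lambda>n. of_nat (m n)"] by auto
    obtain u where u: "u holomorphic_on UNIV" "\<And>n. u (of_nat (m n)) = - of_nat (Suc n)"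
      using entire_interpolation_nat[OF \<open>inj m\<close>, of "\<lambda>n. - of_nat (Suc n)"] by metis
    have "shear u (transpose (shear s (unipotent (Suc n)))) = f (unipotent (Suc n))" for n
      unfolding m by (rule shear_transpose_shear_unipotent) (use s(2) u(2) in metis)+
    then show ?thesis
      using shear_transpose_shear_in_Aut[OF s(1) u(1)]
      by (intro bexI) (auto simp: unipotent_in_SL2C)
  qed
  moreover have "closedin (top_of_set SL2C) ?A"
    using uniform_discrete_imp_closed[OF ud] unipotent_in_SL2C by (intro closed_subset) auto
  ultimately show ?thesis
    unfolding A tame_def
    using uniform_discrete_imp_discrete[OF ud] range_inj_infinite[OF inj] by blast
qed

end
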